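(* For every $k$ with $0 \le k < 3$ and every $n > k$, there is no exploration protocol, even probabilistic, of a ring of $n$ nodes with $k$ robots.
   Context: Model. A ring has $n$ nodes $u_0,\dots,u_{n-1}$ (indices modulo $n$), $u_i$ adjacent to $u_{i-1}$ and $u_{i+1}$; nodes are anonymous and the ring is unoriented. There are $k\le n$ robots located on nodes. Robots are anonymous, uniform (same program, no local parameter), oblivious (no memory between cycles) and do not communicate. A protocol is this common program. Each robot repeatedly executes Look–Compute–Move cycles: in Look it observes the number $d_j(t)$ of robots on every node $u_j$ (multiplicity detection), seen from its own node $u_i$ as the unordered pair $\{\gamma^{+i}(t),\gamma^{-i}(t)\}$ with $\gamma^{+i}(t)=\langle d_i d_{i+1}\dots d_{i+n-1}\rangle$ and $\gamma^{-i}(t)=\langle d_i d_{i-1}\dots d_{i-(n-1)}\rangle$; in Compute it decides, deterministically or with randomness, to stay idle or move to a neighboring node; in Move it moves. If its view is symmetric ($\gamma^{+i}=\gamma^{-i}$) and it decides to move, an adversary chooses which incident edge it traverses. At each instant $t=0,1,2,\dots$ a nonempty set of robots is activated, each executing a full cycle atomically between $t$ and $t+1$. The configuration at instant $t$ is $\langle d_0(t)\dots d_{n-1}(t)\rangle$. A tower is a node holding at least two robots; towerless means no tower. A configuration is terminal if from it the probability that some robot moves is 0. A computation is an infinite sequence of configurations starting from a possible (towerless) initial configuration, each obtained from the previous after a nonempty set of robots executes a cycle; it terminates if it contains a terminal configuration. The scheduler is distributed and fair: any nonempty subset may be activated at each instant and every robot is activated infinitely often. A node is visited if some robot is on it at some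 instant. A protocol deterministically (resp. probabilistically) solves exploration — is an exploration protocol — if every computation starting from a towerless configuration terminates in finite time (resp. finite expected time; non-terminating computations have probability 0) and every node is visited by at least one robot during it.
   Formalization: For k = 0 no nonempty set of robots exists, so read literally there would be no computation and every protocol would explore vacuously; here, with no robots, the empty set is activated and the only computation stays in the empty configuration forever. *)

theory Defs
  imports "HOL-Probability.Probability"
begin

text \<open>
  The nodes \<open>u\<^sub>0, \<dots>, u\<^sub>n\<^sub>-\<^sub>1\<close> are \<open>0, \<dots>, n - 1\<close>. A configuration \<open>d\<close> is the list of the
  multiplicities \<open>d\<^sub>0, \<dots>, d\<^sub>n\<^sub>-\<^sub>1\<close>. A placement \<open>p\<close> of \<open>k\<close> robots is a list of length \<open>k\<close> whose
  entry \<open>p ! r\<close> is the node of robot \<open>r\<close>. The robot indices are only a device of the model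
  (activation and fairness refer to individual robots); the robots themselves never see them.
\<close>

type_synonym config = "nat list"
type_synonym placement = "nat list"

definition is_placement :: "nat \<Rightarrow> nat \<Rightarrow> placement \<Rightarrow> bool" where
  "is_placement n k p \<longleftrightarrow> length p = k \<and> set p \<subseteq> {..<n}"

definition config_of :: "nat \<Rightarrow> placement \<Rightarrow> config" where
  "config_of n p = map (\<lambda>j. card {r. r < length p \<and> p ! r = j}) [0..<n]"

definition towerless :: "config \<Rightarrow> bool" where
  "towerless d \<longleftrightarrow> (\<forall>j<length d. \<not> d ! j \<ge> 2)"

definition succ_node :: "nat \<Rightarrow> nat \<Rightarrow> nat" where
  "succ_node n i = (i + 1) mod n"

definition pred_node :: "nat \<Rightarrow> nat \<Rightarrow> nat" where
  "pred_node n i = (i + n - 1) mod n"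

definition gamma_plus :: "config \<Rightarrow> nat \<Rightarrow> nat list" where
  "gamma_plus d i = map (\<lambda>j. d ! ((i + j) mod length d)) [0..<length d]"

definition gamma_minus :: "config \<Rightarrow> nat \<Rightarrow> nat list" where
  "gamma_minus d i = map (\<lambda>j. d ! ((i + length d - j) mod length d)) [0..<length d]"

definition view :: "config \<Rightarrow> nat \<Rightarrow> nat list set" where
  "view d i = {gamma_plus d i, gamma_minus d i}"

text \<open>
  A robot has no sense of direction, so it can name a neighbouring node only by the member of its
  view that is read off in the direction of that neighbour.
\<close>

datatype decision = Idle | Move "nat list"

type_synonym protocol = "nat list set \<Rightarrow> decision pmf"

definition is_protocol :: "protocol \<Rightarrow> bool" where
  "is_protocol P \<longleftrightarrow> (\<forall>V. set_pmf (P V) \<subseteq> insert Idle (Move ` V))"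

text \<open>The bit \<open>b\<close> is the adversary's choice of an edge; it matters only if the view is symmetric.\<close>

fun target :: "config \<Rightarrow> nat \<Rightarrow> bool \<Rightarrow> decision \<Rightarrow> nat" where
  "target d i b Idle = i"
| "target d i b (Move g) =
     (if gamma_plus d i = gamma_minus d i
      then (if b then succ_node (length d) i else pred_node (length d) i)
      else if g = gamma_plus d i then succ_node (length d) i
      else pred_node (length d) i)"

text \<open>
  One instant: the robots in \<open>A\<close> draw their decisions independently, all from the same
  configuration, and move simultaneously; \<open>e\<close> resolves the moves of robots with symmetric views and
  may depend on all the decisions drawn.
\<close>

definition step ::
  "nat \<Rightarrow> protocol \<Rightarrow> nat set \<Rightarrow> ((nat \<Rightarrow> decision) \<Rightarrow> nat \<Rightarrow> bool) \<Rightarrow> placement \<Rightarrow> placement pmf"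
where
  "step n P A e p =
     map_pmf (\<lambda>f. map (\<lambda>r. target (config_of n p) (p ! r) (e f r) (f r)) [0..<length p])
       (Pi_pmf A Idle (\<lambda>r. P (view (config_of n p) (p ! r))))"

text \<open>
  If there are no robots, then no nonempty set of robots exists. The only possible activation is
  then the empty one, and the only computation stays in the empty configuration forever.
\<close>

definition activation :: "nat \<Rightarrow> nat set \<Rightarrow> bool" where
  "activation k A \<longleftrightarrow> A \<subseteq> {..<k} \<and> (k > 0 \<longrightarrow> A \<noteq> {})"

definition fair :: "nat \<Rightarrow> (nat \<Rightarrow> nat set) \<Rightarrow> bool" where
  "fair k A \<longleftrightarrow> (\<forall>r<k. \<exists>\<^sub>\<infinity>t. r \<in> A t)"

definition terminal :: "protocol \<Rightarrow> config \<Rightarrow> bool" where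
  "terminal P d \<longleftrightarrow>
     (\<forall>i<length d. d ! i > 0 \<longrightarrow> measure_pmf.prob (P (view d i)) {a. a \<noteq> Idle} = 0)"

definition terminates :: "nat \<Rightarrow> protocol \<Rightarrow> (nat \<Rightarrow> placement) \<Rightarrow> bool" where
  "terminates n P X \<longleftrightarrow> (\<exists>t. terminal P (config_of n (X t)))"

definition termination_time :: "nat \<Rightarrow> protocol \<Rightarrow> (nat \<Rightarrow> placement) \<Rightarrow> ennreal" where
  "termination_time n P X = (INF t\<in>{t. terminal P (config_of n (X t))}. of_nat t)"

definition visits_all :: "nat \<Rightarrow> (nat \<Rightarrow> placement) \<Rightarrow> bool" where
  "visits_all n X \<longleftrightarrow> (\<forall>j<n. \<exists>t. config_of n (X t) ! j > 0)"

definition initial :: "nat \<Rightarrow> nat \<Rightarrow> placement \<Rightarrow> bool" where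
  "initial n k p \<longleftrightarrow> is_placement n k p \<and> towerless (config_of n p)"

definition computation :: "nat \<Rightarrow> nat \<Rightarrow> protocol \<Rightarrow> (nat \<Rightarrow> placement) \<Rightarrow> bool" where
  "computation n k P X \<longleftrightarrow>
     initial n k (X 0) \<and>
     (\<exists>A. fair k A \<and>
        (\<forall>t. activation k (A t) \<and> (\<exists>e. X (Suc t) \<in> set_pmf (step n P (A t) e (X t)))))"

definition deterministically_solves :: "nat \<Rightarrow> nat \<Rightarrow> protocol \<Rightarrow> bool" where
  "deterministically_solves n k P \<longleftrightarrow>
     (\<forall>X. computation n k P X \<longrightarrow> terminates n P X \<and> visits_all n X)"

text \<open>
  To speak about probabilities, the choices of the adversary are given as functions of the history
  \<open>[X 0, \<dots>, X t]\<close>: the robots it activates at instant \<open>t\<close>, and the edges it chooses.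
\<close>

record adversary =
  act :: "placement list \<Rightarrow> nat set"
  edge :: "placement list \<Rightarrow> (nat \<Rightarrow> decision) \<Rightarrow> nat \<Rightarrow> bool"

definition history :: "(nat \<Rightarrow> placement) \<Rightarrow> nat \<Rightarrow> placement list" where
  "history X t = map X [0..<Suc t]"

definition adv_step ::
  "nat \<Rightarrow> protocol \<Rightarrow> adversary \<Rightarrow> (nat \<Rightarrow> placement) \<Rightarrow> nat \<Rightarrow> placement pmf" where
  "adv_step n P \<sigma> X t = step n P (act \<sigma> (history X t)) (edge \<sigma> (history X t)) (X t)"

definition fair_adversary :: "nat \<Rightarrow> nat \<Rightarrow> protocol \<Rightarrow> placement \<Rightarrow> adversary \<Rightarrow> bool" where
  "fair_adversary n k P p\<^sub>0 \<sigma> \<longleftrightarrow>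
     (\<forall>h. activation k (act \<sigma> h)) \<and>
     (\<forall>X. X 0 = p\<^sub>0 \<and> (\<forall>t. X (Suc t) \<in> set_pmf (adv_step n P \<sigma> X t)) \<longrightarrow>
        fair k (\<lambda>t. act \<sigma> (history X t)))"

fun trans_kernel ::
  "nat \<Rightarrow> protocol \<Rightarrow> adversary \<Rightarrow> placement \<Rightarrow> nat \<Rightarrow> (nat \<Rightarrow> placement) \<Rightarrow> placement measure"
where
  "trans_kernel n P \<sigma> p\<^sub>0 0 X = measure_pmf (return_pmf p\<^sub>0)"
| "trans_kernel n P \<sigma> p\<^sub>0 (Suc t) X = measure_pmf (adv_step n P \<sigma> X t)"

text \<open>
  The law of the random computation from \<open>p\<^sub>0\<close> against \<open>\<sigma>\<close>, obtained from its transition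
  kernels by the Ionescu-Tulcea theorem.
\<close>

definition law :: "nat \<Rightarrow> protocol \<Rightarrow> adversary \<Rightarrow> placement \<Rightarrow> (nat \<Rightarrow> placement) measure" where
  "law n P \<sigma> p\<^sub>0 =
     projective_family.lim UNIV
       (Ionescu_Tulcea.CI (trans_kernel n P \<sigma> p\<^sub>0) (\<lambda>_. count_space UNIV)) (\<lambda>_. count_space UNIV)"

lemma measurable_history:
  "(\<lambda>X. map X [0..<i]) \<in>
     measurable (PiM {0..<i} (\<lambda>_. count_space (UNIV :: placement set))) (count_space UNIV)"
proof -
  have "(\<lambda>X. map X [0..<j]) \<in>
     measurable (PiM {0..<i} (\<lambda>_. count_space (UNIV :: placement set))) (count_space UNIV)"
    if "j \<le> i" for j
    using that
  proof (induction j)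
    case 0
    then show ?case by simp
  next
    case (Suc j)
    have c: "(\<lambda>X. X j) \<in>
        measurable (PiM {0..<i} (\<lambda>_. count_space (UNIV :: placement set))) (count_space UNIV)"
      using Suc.prems by (intro measurable_component_singleton) auto
    have IH: "(\<lambda>X. map X [0..<j]) \<in>
        measurable (PiM {0..<i} (\<lambda>_. count_space (UNIV :: placement set))) (count_space UNIV)"
      using Suc by simp
    have "(\<lambda>X. (\<lambda>h X. h @ [X j]) (map X [0..<j]) X) \<in>
        measurable (PiM {0..<i} (\<lambda>_. count_space (UNIV :: placement set))) (count_space UNIV)"
      by (rule measurable_compose_countable[OF _ IH])
         (rule measurable_compose[OF c], simp)
    then show ?case by simp
  qed
  then show ?thesis by blast
qed

lemma Ionescu_Tulcea_trans_kernel: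
  "Ionescu_Tulcea (trans_kernel n P \<sigma> p\<^sub>0) (\<lambda>_. count_space UNIV)"
proof (rule Ionescu_Tulcea.intro)
  fix i
  let ?S = "subprob_algebra (count_space (UNIV :: placement set))"
  show "trans_kernel n P \<sigma> p\<^sub>0 i \<in> measurable (PiM {0..<i} (\<lambda>_. count_space UNIV)) ?S"
  proof (cases i)
    case 0
    have "trans_kernel n P \<sigma> p\<^sub>0 0 = (\<lambda>_. measure_pmf (return_pmf p\<^sub>0))" by auto
    then show ?thesis using 0 by (simp add: measure_pmf_in_subprob_algebra)
  next
    case (Suc t)
    define g where "g h = measure_pmf (step n P (act \<sigma> h) (edge \<sigma> h) (last h))" for h
    have "trans_kernel n P \<sigma> p\<^sub>0 (Suc t) = (\<lambda>X. g (map X [0..<Suc t]))"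
      by (auto simp: g_def adv_step_def history_def fun_eq_iff)
    moreover have "g \<in> measurable (count_space UNIV) ?S"
      by (simp add: g_def measure_pmf_in_subprob_algebra)
    ultimately show ?thesis
      using measurable_compose[OF measurable_history[of "Suc t"]] Suc by simp
  qed
next
  fix i :: nat and X :: "nat \<Rightarrow> placement"
  assume "X \<in> space (PiM {0..<i} (\<lambda>_. count_space (UNIV :: placement set)))"
  show "prob_space (trans_kernel n P \<sigma> p\<^sub>0 i X)"
    by (cases i) (auto simp: prob_space_measure_pmf)
qed

lemma prob_space_law: "prob_space (law n P \<sigma> p\<^sub>0)"
proof -
  interpret IT: Ionescu_Tulcea "trans_kernel n P \<sigma> p\<^sub>0" "\<lambda>_. count_space UNIV"
    by (rule Ionescu_Tulcea_trans_kernel)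
  have "prob_space (distr IT.PF.lim (PiM {} (\<lambda>_. count_space UNIV)) (\<lambda>x. restrict x {}))"
    unfolding IT.distr_lim[OF finite.emptyI] by (intro IT.PF.prob_space_P) auto
  then show ?thesis
    unfolding law_def
    by (rule prob_space_distrD[rotated])
       (auto intro!: measurable_restrict simp: measurable_cong_sets[OF IT.PF.sets_lim refl])
qed

definition probabilistically_solves :: "nat \<Rightarrow> nat \<Rightarrow> protocol \<Rightarrow> bool" where
  "probabilistically_solves n k P \<longleftrightarrow>
     (\<forall>p\<^sub>0 \<sigma>. initial n k p\<^sub>0 \<and> fair_adversary n k P p\<^sub>0 \<sigma> \<longrightarrow>
        (AE X in law n P \<sigma> p\<^sub>0. terminates n P X) \<and>
        (\<integral>\<^sup>+ X. termination_time n P X \<partial>law n P \<sigma> p\<^sub>0) < \<infinity> \<and>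
        (AE X in law n P \<sigma> p\<^sub>0. visits_all n X))"

definition exploration_protocol :: "nat \<Rightarrow> nat \<Rightarrow> protocol \<Rightarrow> bool" where
  "exploration_protocol n k P \<longleftrightarrow>
     is_protocol P \<and> (deterministically_solves n k P \<or> probabilistically_solves n k P)"

end

theory Submission
  imports Defs
begin

text \<open>
  A terminal configuration is never left, so a towerless configuration cannot be terminal: started
  there, the robots would visit only \<open>k < n\<close> nodes. For \<open>k \<le> 1\<close> there are no towers, hence no
  terminating computation. For \<open>k = 2\<close> let a round-robin adversary activate one robot at a time,
  starting from two adjacent robots. If a robot next to the other one moves onto it with positive
  probability, then the very first move may create a tower. All towers look alike, so this one is
  terminal, and only two nodes have been visited. Otherwise no tower is ever created, and the
  computation does not terminate.
\<close>

section \<open>Runs against an adversary\<close>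

text \<open>Membership in the support replaces probabilities here, so that one notion serves both
  kinds of exploration.\<close>

definition run ::
  "nat \<Rightarrow> protocol \<Rightarrow> adversary \<Rightarrow> placement \<Rightarrow> (nat \<Rightarrow> placement) \<Rightarrow> bool" where
  "run n P \<sigma> p\<^sub>0 X \<longleftrightarrow> X 0 = p\<^sub>0 \<and> (\<forall>t. X (Suc t) \<in> set_pmf (adv_step n P \<sigma> X t))"

lemma trans_kernel_cong:
  assumes "\<And>i. i < m \<Longrightarrow> X i = Y i"
  shows "trans_kernel n P \<sigma> p\<^sub>0 m X = trans_kernel n P \<sigma> p\<^sub>0 m Y"
proof (cases m)
  case (Suc t)
  with assms have "history X t = history Y t" "X t = Y t"
    by (auto simp: history_def)
  with Suc show ?thesis by (simp add: adv_step_def)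
qed simp

text \<open>\<open>R\<close> reads only a finite prefix, whose law is the finite iterate
  \<open>IT.C 0 (Suc m)\<close>. That iterate is the one for \<open>m\<close> bound to the kernel
  extension \<open>IT.eP m\<close>, so the almost-everywhere quantifier splits in two.\<close>

lemma AE_law_Suc:
  "(AE X in law n P \<sigma> p\<^sub>0. R (map X [0..<Suc m])) \<longleftrightarrow>
   (AE X in law n P \<sigma> p\<^sub>0. AE x in trans_kernel n P \<sigma> p\<^sub>0 m X. R (map X [0..<m] @ [x]))"
proof -
  let ?M = "\<lambda>_::nat. count_space (UNIV :: placement set)"
  let ?K = "trans_kernel n P \<sigma> p\<^sub>0"
  interpret IT: Ionescu_Tulcea ?K ?M
    by (rule Ionescu_Tulcea_trans_kernel)
  have meas: "Measurable.pred (PiM {0..<i} ?M) (\<lambda>X. Q (map X [0..<i]))" for Q i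
    by (rule measurable_compose[OF measurable_history]) simp
  have und: "(\<lambda>_. undefined) \<in> space (PiM {0..<0::nat} ?M)"
    by (simp add: space_PiM)
  have law_C: "(AE X in law n P \<sigma> p\<^sub>0. Q (map X [0..<i])) \<longleftrightarrow>
      (AE X in IT.C 0 i (\<lambda>_. undefined). Q (map X [0..<i]))" for Q i
  proof -
    have upt: "IT.up_to {0..<i} = i"
      unfolding IT.up_to_def by (rule Least_equality) (auto simp: not_less_eq_eq)
    have restr: "map (restrict X {0..<i}) [0..<i] = map X [0..<i]" for X :: "nat \<Rightarrow> placement"
      by simp
    have m1: "(\<lambda>X. restrict X {0..<i}) \<in> measurable IT.PF.lim (PiM {0..<i} ?M)"
      by (auto intro!: measurable_restrict simp: measurable_cong_sets[OF IT.PF.sets_lim refl])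
    have m2: "(\<lambda>X. restrict X {0..<i}) \<in>
        measurable (IT.C 0 i (\<lambda>_. undefined)) (PiM {0..<i} ?M)"
      by (subst measurable_cong_sets[OF IT.sets_C[OF und] refl]) (auto intro!: measurable_restrict)
    have "(AE X in law n P \<sigma> p\<^sub>0. Q (map X [0..<i])) \<longleftrightarrow>
        (AE X in IT.CI {0..<i}. Q (map X [0..<i]))"
      unfolding IT.distr_lim[OF finite_atLeastLessThan, symmetric] law_def
      using meas[of Q i] by (subst AE_distr_iff[OF m1]) (simp_all only: restr pred_def)
    also have "\<dots> \<longleftrightarrow> (AE X in IT.C 0 i (\<lambda>_. undefined). Q (map X [0..<i]))"
      unfolding IT.CI_def upt
      using meas[of Q i] by (subst AE_distr_iff[OF m2]) (simp_all only: restr pred_def)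
    finally show ?thesis .
  qed
  have "(AE X in law n P \<sigma> p\<^sub>0. R (map X [0..<Suc m])) \<longleftrightarrow>
      (AE Y in IT.C 0 m (\<lambda>_. undefined) \<bind> IT.eP m. R (map Y [0..<Suc m]))"
    by (simp only: law_C[of R "Suc m"] IT.C.simps add_0)
  also have "\<dots> \<longleftrightarrow>
      (AE X in IT.C 0 m (\<lambda>_. undefined). AE Y in IT.eP m X. R (map Y [0..<Suc m]))"
  proof (rule AE_bind)
    show "IT.eP m \<in> measurable (IT.C 0 m (\<lambda>_. undefined))
        (subprob_algebra (PiM {0..<Suc m} ?M))"
      by (subst measurable_cong_sets[OF IT.sets_C[OF und] refl]) (simp add: IT.measurable_eP)
  qed (rule meas)
  \<comment> \<open>The kernel reads only coordinates below \<open>m\<close>. Feeding it the prefix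
    list makes the inner statement a predicate of that list, so \<open>law_C\<close> can lead back
    to \<open>law\<close>.\<close>
  also have "\<dots> \<longleftrightarrow> (AE X in IT.C 0 m (\<lambda>_. undefined).
      AE x in ?K m ((!) (map X [0..<m])). R (map X [0..<m] @ [x]))"
  proof (rule AE_cong)
    fix X assume "X \<in> space (IT.C 0 m (\<lambda>_. undefined))"
    then have X: "X \<in> space (PiM {0..<m} ?M)"
      using IT.space_C[OF und, of m] by simp
    have K: "?K m ((!) (map X [0..<m])) = ?K m X"
      by (rule trans_kernel_cong) simp
    have upd: "map (X(m := x)) [0..<Suc m] = map X [0..<m] @ [x]" for x
      by simp
    have "fun_upd X m \<in> measurable (?K m X) (PiM {0..<Suc m} ?M)"
      using X
      by (subst measurable_cong_sets[OF IT.sets_P[OF X] refl],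
          intro measurable_fun_upd[where J="{0..<m}"]) auto
    then show "(AE Y in IT.eP m X. R (map Y [0..<Suc m])) \<longleftrightarrow>
        (AE x in ?K m ((!) (map X [0..<m])). R (map X [0..<m] @ [x]))"
      unfolding IT.eP_def K
      using meas[of R "Suc m"] by (subst AE_distr_iff) (simp_all only: upd pred_def)
  qed
  also have "\<dots> \<longleftrightarrow> (AE X in law n P \<sigma> p\<^sub>0.
      AE x in ?K m ((!) (map X [0..<m])). R (map X [0..<m] @ [x]))"
    using law_C[of "\<lambda>h. AE x in ?K m ((!) h). R (h @ [x])" m] by simp
  also have "\<dots> \<longleftrightarrow> (AE X in law n P \<sigma> p\<^sub>0. AE x in ?K m X. R (map X [0..<m] @ [x]))"
  proof -
    have "?K m ((!) (map X [0..<m])) = ?K m X" for X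
      by (rule trans_kernel_cong) simp
    then show ?thesis by (simp only:)
  qed
  finally show ?thesis .
qed

text \<open>Each transition is a condition on a finite prefix and holds on the support of a discrete
  kernel; there are only countably many instants.\<close>

lemma AE_law_run: "AE X in law n P \<sigma> p\<^sub>0. run n P \<sigma> p\<^sub>0 X"
proof -
  have "AE X in law n P \<sigma> p\<^sub>0. map X [0..<Suc 0] = [p\<^sub>0]"
    unfolding AE_law_Suc[where R = "\<lambda>h. h = [p\<^sub>0]"] trans_kernel.simps AE_measure_pmf_iff by simp
  moreover have "AE X in law n P \<sigma> p\<^sub>0. X (Suc t) \<in> set_pmf (adv_step n P \<sigma> X t)" for t
  proof -
    \<comment> \<open>On a prefix of length \<open>t + 2\<close>, \<open>last h\<close> is the new
      placement and \<open>butlast h\<close> the history it was drawn from.\<close>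
    let ?R = "\<lambda>h. last h \<in> set_pmf
      (step n P (act \<sigma> (butlast h)) (edge \<sigma> (butlast h)) (last (butlast h)))"
    have butlast: "butlast (xs @ [x, y]) = xs @ [x]" for xs and x y :: placement
      by (induction xs) auto
    have "AE X in law n P \<sigma> p\<^sub>0. ?R (map X [0..<Suc (Suc t)])"
      unfolding AE_law_Suc[where R = ?R] trans_kernel.simps AE_measure_pmf_iff
      by (simp add: adv_step_def history_def butlast)
    then show ?thesis by (simp add: adv_step_def history_def butlast)
  qed
  ultimately show ?thesis
    by (simp add: run_def AE_all_countable)
qed

lemma not_AE_law_avoids:
  assumes "p\<^sub>1 \<in> set_pmf (step n P (act \<sigma> [p\<^sub>0]) (edge \<sigma> [p\<^sub>0]) p\<^sub>0)"
  shows "\<not> (AE X in law n P \<sigma> p\<^sub>0. X 1 \<noteq> p\<^sub>1)"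
proof
  interpret prob_space "law n P \<sigma> p\<^sub>0" by (rule prob_space_law)
  assume "AE X in law n P \<sigma> p\<^sub>0. X 1 \<noteq> p\<^sub>1"
  then have "AE X in law n P \<sigma> p\<^sub>0. (\<lambda>h. last h \<noteq> p\<^sub>1) (map X [0..<Suc (Suc 0)])"
    by simp
  then have "AE X in law n P \<sigma> p\<^sub>0. AE x in adv_step n P \<sigma> X 0. x \<noteq> p\<^sub>1"
    unfolding AE_law_Suc[where R = "\<lambda>h. last h \<noteq> p\<^sub>1"] trans_kernel.simps by simp
  with AE_law_run have "AE X in law n P \<sigma> p\<^sub>0. False"
    by eventually_elim (use assms in \<open>auto simp: AE_measure_pmf_iff adv_step_def history_def run_def\<close>)
  then show False by simp
qed

lemma run_exists:
  assumes p1: "p\<^sub>1 \<in> set_pmf (step n P (act \<sigma> [p\<^sub>0]) (edge \<sigma> [p\<^sub>0]) p\<^sub>0)"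
  obtains X where "run n P \<sigma> p\<^sub>0 X" "X 1 = p\<^sub>1"
proof -
  define S where "S h = set_pmf (step n P (act \<sigma> h) (edge \<sigma> h) (last h))" for h
  \<comment> \<open>The recursion builds whole histories, since the adversary's choices depend on
    them.\<close>
  define H where "H = rec_nat [p\<^sub>0] (\<lambda>t h. h @ [if t = 0 then p\<^sub>1 else SOME q. q \<in> S h])"
  have H0: "H 0 = [p\<^sub>0]"
    and HS: "H (Suc t) = H t @ [if t = 0 then p\<^sub>1 else SOME q. q \<in> S (H t)]" for t
    by (simp_all add: H_def)
  define X where "X t = last (H t)" for t
  have hist: "history X t = H t" for t
    by (induction t) (auto simp: history_def X_def H0 HS)
  have "X (Suc t) \<in> S (H t)" for t
  proof (cases t)
    case 0
    then show ?thesis using p1 by (simp add: X_def H0 HS S_def)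
  next
    case Suc
    have "S (H t) \<noteq> {}" by (simp add: S_def set_pmf_not_empty)
    then show ?thesis using Suc by (simp add: X_def HS some_in_eq)
  qed
  then have "run n P \<sigma> p\<^sub>0 X"
    by (simp add: run_def adv_step_def hist S_def) (simp add: X_def H0)
  moreover have "X 1 = p\<^sub>1" by (simp add: X_def HS)
  ultimately show thesis by (rule that)
qed

text \<open>
  The first step is prescribed because a bad first step of positive probability already refutes
  both kinds of exploration.
\<close>

lemma exploration_protocol_good_run:
  assumes expl: "exploration_protocol n k P"
    and init: "initial n k p\<^sub>0" and fair: "fair_adversary n k P p\<^sub>0 \<sigma>"
    and p1: "p\<^sub>1 \<in> set_pmf (step n P (act \<sigma> [p\<^sub>0]) (edge \<sigma> [p\<^sub>0]) p\<^sub>0)"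
  obtains X where "run n P \<sigma> p\<^sub>0 X" "X 1 = p\<^sub>1" "terminates n P X" "visits_all n X"
proof -
  consider "deterministically_solves n k P" | "probabilistically_solves n k P"
    using expl by (auto simp: exploration_protocol_def)
  then show thesis
  proof cases
    case 1
    obtain X where X: "run n P \<sigma> p\<^sub>0 X" "X 1 = p\<^sub>1"
      using p1 by (rule run_exists)
    have "computation n k P X"
      using X(1) init fair
      unfolding computation_def run_def fair_adversary_def adv_step_def by blast
    with 1 have "terminates n P X" "visits_all n X"
      by (auto simp: deterministically_solves_def)
    with X show thesis by (rule that)
  next
    case 2
    then have "AE X in law n P \<sigma> p\<^sub>0. terminates n P X" "AE X in law n P \<sigma> p\<^sub>0. visits_all n X"
      using init fair by (auto simp: probabilistically_solves_def)
    with AE_law_run have good: "AE X in law n P \<sigma> p\<^sub>0.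
        run n P \<sigma> p\<^sub>0 X \<and> terminates n P X \<and> visits_all n X"
      by eventually_elim blast
    \<comment> \<open>An almost sure event must meet the event \<open>X 1 = p\<^sub>1\<close>, which
      is not null.\<close>
    have "\<exists>X. (run n P \<sigma> p\<^sub>0 X \<and> terminates n P X \<and> visits_all n X) \<and> X 1 = p\<^sub>1"
    proof (rule ccontr)
      assume "\<not> ?thesis"
      then have "AE X in law n P \<sigma> p\<^sub>0. X 1 \<noteq> p\<^sub>1"
        by (intro eventually_mono[OF good]) blast
      with not_AE_law_avoids[OF p1] show False ..
    qed
    with that show thesis by blast
  qed
qed

section \<open>The round-robin adversary and terminal configurations\<close>

text \<open>The intersection matters only for \<open>k = 0\<close>, where \<open>length h mod 0 = length h\<close>.\<close>

definition round_robin :: "nat \<Rightarrow> adversary" where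
  "round_robin k = \<lparr>act = \<lambda>h. {length h mod k} \<inter> {..<k}, edge = \<lambda>_ _ _. True\<rparr>"

lemma fair_round_robin: "fair_adversary n k P p\<^sub>0 (round_robin k)"
proof -
  have "\<exists>\<^sub>\<infinity>t. r \<in> act (round_robin k) (history X t)" if "r < k" for r X
    unfolding INFM_nat_le
  proof
    fix m
    \<comment> \<open>The history at instant \<open>t\<close> has length \<open>Suc t\<close>, so
      robot \<open>r\<close> is active when \<open>Suc t\<close> is congruent to \<open>r\<close>
      modulo \<open>k\<close>.\<close>
    have "m * k + (k + r - 1) \<ge> m" "Suc (m * k + (k + r - 1)) = r + Suc m * k"
      using that by (cases k; simp)+
    then show "\<exists>t\<ge>m. r \<in> act (round_robin k) (history X t)"
      using that
      by (intro exI[of _ "m * k + (k + r - 1)"]) (simp add: round_robin_def history_def)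
  qed
  then show ?thesis
    by (auto simp: fair_adversary_def fair_def activation_def round_robin_def)
qed

section \<open>Supports of single steps and the dynamics at terminal configurations\<close>

lemma set_pmf_step:
  assumes "finite A"
  shows "set_pmf (step n P A e p) =
    (\<lambda>f. map (\<lambda>r. target (config_of n p) (p ! r) (e f r) (f r)) [0..<length p]) `
      PiE_dflt A Idle (\<lambda>r. set_pmf (P (view (config_of n p) (p ! r))))"
  using assms by (simp add: step_def set_Pi_pmf comp_def)

lemma length_config_of [simp]: "length (config_of n p) = n"
  by (simp add: config_of_def)

lemma config_of_pos_iff:
  assumes "j < n"
  shows "config_of n p ! j > 0 \<longleftrightarrow> j \<in> set p"
proof -
  have "finite {r. r < length p \<and> p ! r = j}" by simp
  then show ?thesis
    using assms by (auto simp: config_of_def card_gt_0_iff in_set_conv_nth)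
qed

lemma is_placement_nth_less: "is_placement n k p \<Longrightarrow> r < length p \<Longrightarrow> p ! r < n"
  using nth_mem[of r p] unfolding is_placement_def by blast

lemma target_less:
  assumes "i < length d"
  shows "target d i b a < length d"
proof -
  have "length d > 0" using assms by linarith
  then show ?thesis
    using assms by (cases a) (simp_all add: succ_node_def pred_node_def)
qed

lemma is_placement_step:
  assumes "is_placement n k p" "finite A" "q \<in> set_pmf (step n P A e p)"
  shows "is_placement n k q"
proof -
  have "target (config_of n p) (p ! r) b a < n" if "r < length p" for r b a
    using target_less[of "p ! r" "config_of n p"] is_placement_nth_less[OF assms(1) that] by simp
  then show ?thesis
    using assms by (auto simp: set_pmf_step is_placement_def)
qed

text \<open>Probability 0 under a discrete distribution means absence from its support, so every
  decision drawn is \<open>Idle\<close>.\<close>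

lemma terminal_step:
  assumes "terminal P (config_of n p)" "is_placement n k p" "finite A"
    and "q \<in> set_pmf (step n P A e p)"
  shows "q = p"
proof -
  obtain f where f: "f \<in> PiE_dflt A Idle (\<lambda>r. set_pmf (P (view (config_of n p) (p ! r))))"
    and q: "q = map (\<lambda>r. target (config_of n p) (p ! r) (e f r) (f r)) [0..<length p]"
    using assms by (auto simp: set_pmf_step)
  have "f r = Idle" if r: "r < length p" for r
  proof (cases "r \<in> A")
    case True
    have "p ! r < n" "config_of n p ! (p ! r) > 0"
      using is_placement_nth_less[OF assms(2) r] r by (auto simp: config_of_pos_iff)
    then have "measure_pmf.prob (P (view (config_of n p) (p ! r))) {a. a \<noteq> Idle} = 0"
      using assms(1) by (simp add: terminal_def)
    then have "set_pmf (P (view (config_of n p) (p ! r))) \<inter> {a. a \<noteq> Idle} = {}"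
      by (simp add: measure_pmf_zero_iff)
    with f True show ?thesis by (auto simp: PiE_dflt_def)
  \<comment> \<open>Outside \<open>A\<close> the decision is the default value
    \<open>Idle\<close>.\<close>
  qed (use f in \<open>auto simp: PiE_dflt_def\<close>)
  then show ?thesis
    using q by (auto intro: nth_equalityI)
qed

text \<open>Because histories have length \<open>Suc t\<close>, the first of two robots to act is
  robot 1, not robot 0.\<close>

lemma round_robin_run_step:
  assumes "run n P (round_robin k) p\<^sub>0 X"
  shows "X (Suc t) \<in> set_pmf (step n P ({Suc t mod k} \<inter> {..<k}) (\<lambda>_ _. True) (X t))"
  using assms by (simp add: run_def adv_step_def round_robin_def history_def)

lemma run_is_placement:
  assumes "run n P (round_robin k) p\<^sub>0 X" "is_placement n k p\<^sub>0"
  shows "is_placement n k (X t)"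
proof (induction t)
  case (Suc t)
  then show ?case
    using is_placement_step round_robin_run_step[OF assms(1)] by blast
qed (use assms in \<open>simp add: run_def\<close>)

lemma run_terminal_const:
  assumes "run n P (round_robin k) p\<^sub>0 X" "is_placement n k p\<^sub>0"
    and "terminal P (config_of n (X s))" "s \<le> t"
  shows "X t = X s"
  using \<open>s \<le> t\<close>
proof (induction t rule: dec_induct)
  case (step t)
  then show ?case
    using terminal_step[OF _ run_is_placement[OF assms(1,2)] _ round_robin_run_step[OF assms(1)]]
      assms(3) by simp
qed simp

text \<open>This applies beyond the start of a run: any towerless placement reached later is itself
  a possible initial one.\<close>

lemma initial_not_terminal:
  assumes expl: "exploration_protocol n k P" and "k < n" and init: "initial n k p"
  shows "\<not> terminal P (config_of n p)"
proof
  assume trm: "terminal P (config_of n p)"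
  have pl: "is_placement n k p" using init by (simp add: initial_def)
  obtain q where "q \<in> set_pmf (step n P (act (round_robin k) [p]) (edge (round_robin k) [p]) p)"
    using set_pmf_not_empty by fast
  then obtain X where X: "run n P (round_robin k) p X" "visits_all n X"
    by (rule exploration_protocol_good_run[OF expl init fair_round_robin])
  have X_const: "X t = p" for t
    using run_terminal_const[OF X(1) pl, of 0 t] trm X(1) by (simp add: run_def)
  then have "{..<n} \<subseteq> set p"
    using X(2) by (auto simp: visits_all_def config_of_pos_iff)
  then have "n \<le> card (set p)"
    using card_mono[of "set p" "{..<n}"] by simp
  also have "\<dots> \<le> k"
    using card_length[of p] pl by (simp add: is_placement_def)
  finally show False using \<open>k < n\<close> by simp
qed

lemma towerless_config_of_iff:
  assumes "is_placement n k p"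
  shows "towerless (config_of n p) \<longleftrightarrow> distinct p"
proof
  assume tl: "towerless (config_of n p)"
  show "distinct p"
    unfolding distinct_conv_nth
  proof (intro allI impI notI)
    fix i j assume ij: "i < length p" "j < length p" "i \<noteq> j" "p ! i = p ! j"
    then have "card {i, j} \<le> card {r. r < length p \<and> p ! r = p ! i}"
      by (intro card_mono) auto
    moreover have "p ! i < n"
      using is_placement_nth_less[OF assms ij(1)] .
    ultimately show False
      using tl ij by (auto simp: towerless_def config_of_def)
  qed
next
  assume dist: "distinct p"
  have "card {r. r < length p \<and> p ! r = j} \<le> 1" for j
    unfolding One_nat_def
    by (subst card_le_Suc0_iff_eq) (use dist in \<open>auto simp: distinct_conv_nth\<close>)
  then show "towerless (config_of n p)"
    by (auto simp: towerless_def config_of_def not_le less_Suc_eq_le numeral_2_eq_2)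
qed

section \<open>Two robots\<close>

lemma config_of_pair:
  "config_of n [a, b] = map (\<lambda>j. of_bool (j = a) + of_bool (j = b)) [0..<n]"
proof -
  have "{r. r < length [a, b] \<and> [a, b] ! r = j} =
      (if j = a then {0} else {}) \<union> (if j = b then {1} else {})" for j
    by (auto simp: less_Suc_eq nth_Cons')
  then show ?thesis
    by (auto simp: config_of_def)
qed

lemma config_of_pair_commute: "config_of n [a, b] = config_of n [b, a]"
  by (simp add: config_of_pair add.commute)

text \<open>
  The two readings of the ring by a robot whose only companion is on a neighbouring node, in the
  direction of the companion and in the opposite direction.
\<close>

definition towards :: "nat \<Rightarrow> nat list" where
  "towards n = map (\<lambda>j. of_bool (j = 0) + of_bool (j = 1)) [0..<n]"

definition away :: "nat \<Rightarrow> nat list" where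
  "away n = map (\<lambda>j. of_bool (j = 0) + of_bool (j = n - 1)) [0..<n]"

text \<open>The companion appears at entry 1 in one reading and at entry \<open>n - 1\<close> in the
  other. Hence a robot beside its companion has an asymmetric view, and its decision alone fixes the
  edge.\<close>

lemma towards_neq_away:
  assumes "n \<ge> 3"
  shows "towards n \<noteq> away n"
proof
  assume "towards n = away n"
  then have "towards n ! 1 = away n ! 1" by simp
  moreover have "1 \<noteq> n - 1" using assms by linarith
  ultimately show False using assms by (simp add: towards_def away_def)
qed

text \<open>Ring indices below stay under \<open>2 * n\<close>, so this reduces them to linear
  arithmetic with case splits.\<close>

lemma mod_less_double: "(x::nat) < 2 * n \<Longrightarrow> x mod n = (if x < n then x else x - n)"
  by (simp add: le_mod_geq not_less)

text \<open>The two robots share the view \<open>{towards n, away n}\<close>, with the directions of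
  reading reversed.\<close>

lemma gamma_adjacent:
  fixes n a :: nat
  assumes "n \<ge> 3" "a < n"
  defines "b \<equiv> succ_node n a"
  shows "gamma_plus (config_of n [a, b]) a = towards n"
    and "gamma_minus (config_of n [a, b]) a = away n"
    and "gamma_plus (config_of n [a, b]) b = away n"
    and "gamma_minus (config_of n [a, b]) b = towards n"
proof -
  have b: "b = (if a + 1 < n then a + 1 else 0)"
    using assms by (auto simp: b_def succ_node_def mod_less_double)
  have "b < n" using b assms by auto
  show "gamma_plus (config_of n [a, b]) a = towards n"
    "gamma_minus (config_of n [a, b]) a = away n"
    "gamma_plus (config_of n [a, b]) b = away n"
    "gamma_minus (config_of n [a, b]) b = towards n"
    unfolding gamma_plus_def gamma_minus_def towards_def away_def length_config_of
    using assms(1,2) \<open>b < n\<close>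
    by (auto simp: config_of_pair mod_less_double b split: if_splits)
qed

lemma gamma_tower:
  assumes "a < n"
  shows "gamma_plus (config_of n [a, a]) a = map (\<lambda>j. 2 * of_bool (j = 0)) [0..<n]"
    and "gamma_minus (config_of n [a, a]) a = map (\<lambda>j. 2 * of_bool (j = 0)) [0..<n]"
  unfolding gamma_plus_def gamma_minus_def length_config_of
  using assms by (auto simp: config_of_pair mod_less_double split: if_splits)

text \<open>The only occupied node has a symmetric view that does not depend on its
  position.\<close>

lemma terminal_tower_iff:
  assumes "a < n" "b < n"
  shows "terminal P (config_of n [a, a]) \<longleftrightarrow> terminal P (config_of n [b, b])"
proof -
  have "terminal P (config_of n [c, c]) \<longleftrightarrow>
      measure_pmf.prob (P {map (\<lambda>j. 2 * of_bool (j = 0)) [0..<n]}) {a. a \<noteq> Idle} = 0"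
    if "c < n" for c
    using that gamma_tower[OF that]
    by (auto simp: terminal_def config_of_pos_iff view_def)
  with assms show ?thesis by blast
qed

text \<open>A move reaching \<open>j\<close> shows that \<open>i\<close> and \<open>j\<close> are
  adjacent. The view of \<open>i\<close> is then asymmetric, so the chosen reading must be the one
  in the direction of \<open>j\<close>.\<close>

lemma move_onto_neighbour:
  assumes "n \<ge> 3" "is_protocol P" and i: "i < n" and j: "j < n" and ij: "i \<noteq> j"
    and \<delta>: "\<delta> \<in> set_pmf (P (view (config_of n [i, j]) i))"
    and tgt: "target (config_of n [i, j]) i c \<delta> = j"
  shows "Move (towards n) \<in> set_pmf (P {towards n, away n})"
proof -
  let ?d = "config_of n [i, j]"
  obtain g where g: "\<delta> = Move g" using tgt ij by (cases \<delta>) auto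
  have g_mem: "g \<in> view ?d i"
    using \<open>is_protocol P\<close> \<delta> unfolding is_protocol_def g by blast
  \<comment> \<open>On at least three nodes the two neighbours differ, so the target reveals which
    reading was chosen.\<close>
  have neq: "succ_node n i \<noteq> pred_node n i"
    using assms(1) i by (auto simp: succ_node_def pred_node_def mod_less_double)
  have "j = succ_node n i \<or> j = pred_node n i"
    using tgt by (auto simp: g split: if_splits)
  then show ?thesis
  proof
    assume succ: "j = succ_node n i"
    then have "gamma_plus ?d i = towards n" "gamma_minus ?d i = away n"
      using gamma_adjacent[OF assms(1) i] by auto
    with g_mem \<delta> tgt succ neq towards_neq_away[OF assms(1)] show ?thesis
      by (auto simp: g view_def split: if_splits)
  next
    assume pred: "j = pred_node n i"
    then have "i = succ_node n j"
      using assms(1) i by (auto simp: succ_node_def pred_node_def mod_less_double)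
    then have "gamma_plus ?d i = away n" "gamma_minus ?d i = towards n"
      using gamma_adjacent[OF assms(1) j] by (simp_all add: config_of_pair_commute[of n _ j])
    with g_mem \<delta> tgt pred neq towards_neq_away[OF assms(1)] show ?thesis
      by (auto simp: g view_def insert_commute split: if_splits)
  qed
qed

text \<open>With at most one robot moving, a collision is a move onto an occupied node. Two
  simultaneous moves could instead meet on a free node, whence the activation set
  \<open>{s}\<close>.\<close>

lemma single_move_distinct:
  assumes "n \<ge> 3" "is_protocol P" and no_move: "Move (towards n) \<notin> set_pmf (P {towards n, away n})"
    and pl: "is_placement n 2 p" and "distinct p" and q: "q \<in> set_pmf (step n P {s} e p)"
  shows "distinct q"
proof (rule ccontr)
  obtain a b where p: "p = [a, b]"
    using pl by (auto simp: is_placement_def length_Suc_conv numeral_2_eq_2)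
  have ab: "a < n" "b < n" "a \<noteq> b"
    using pl \<open>distinct p\<close> by (auto simp: p is_placement_def)
  obtain f where f: "f \<in> PiE_dflt {s} Idle (\<lambda>r. set_pmf (P (view (config_of n p) (p ! r))))"
    and q: "q = map (\<lambda>r. target (config_of n p) (p ! r) (e f r) (f r)) [0..<length p]"
    using q by (auto simp: set_pmf_step)
  assume "\<not> distinct q"
  then have eq: "target (config_of n [a, b]) a (e f 0) (f 0) =
      target (config_of n [a, b]) b (e f 1) (f 1)"
    by (simp add: q p)
  consider "s = 0" | "s = 1" | "s \<noteq> 0" "s \<noteq> 1" by blast
  then show False
  proof cases
    case 1
    with f have "f 1 = Idle" "f 0 \<in> set_pmf (P (view (config_of n [a, b]) a))"
      by (auto simp: PiE_dflt_def p)
    with eq show False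
      using move_onto_neighbour[OF assms(1,2) ab] no_move by simp
  next
    case 2
    with f have "f 0 = Idle" "f 1 \<in> set_pmf (P (view (config_of n [b, a]) b))"
      by (auto simp: PiE_dflt_def p config_of_pair_commute[of n b])
    with eq show False
      using move_onto_neighbour[OF assms(1,2) ab(2,1)] ab(3) no_move
      by (metis config_of_pair_commute target.simps(1))
  next
    case 3
    with f have "f 0 = Idle" "f 1 = Idle" by (auto simp: PiE_dflt_def)
    with eq ab show False by simp
  qed
qed

lemma no_exploration_two_robots:
  assumes "n \<ge> 3"
  shows "\<not> exploration_protocol n 2 P"
proof
  assume expl: "exploration_protocol n 2 P"
  then have prot: "is_protocol P" by (simp add: exploration_protocol_def)
  \<comment> \<open>Consequently any terminal configuration of two robots is a tower.\<close>
  have not_term: "\<not> terminal P (config_of n p)" if "is_placement n 2 p" "distinct p" for p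
    using initial_not_terminal[OF expl] that assms
    by (auto simp: initial_def towerless_config_of_iff)
  let ?p = "[0, 1] :: placement"
  let ?S = "set_pmf (step n P (act (round_robin 2) [?p]) (edge (round_robin 2) [?p]) ?p)"
  have pl: "is_placement n 2 ?p" using assms by (simp add: is_placement_def)
  then have init: "initial n 2 ?p" by (auto simp: initial_def towerless_config_of_iff)
  note good_run = exploration_protocol_good_run[OF expl init fair_round_robin]
  show False
  proof (cases "Move (towards n) \<in> set_pmf (P {towards n, away n})")
    case True
    have "succ_node n 0 = 1" "pred_node n 1 = 0"
      using assms by (auto simp: succ_node_def pred_node_def)
    then have \<gamma>: "gamma_plus (config_of n ?p) 1 = away n" "gamma_minus (config_of n ?p) 1 = towards n"
      and pred: "pred_node n 1 = 0"
      using gamma_adjacent[OF assms, of 0] assms by auto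
    have "act (round_robin 2) [?p] = {1}" by (auto simp: round_robin_def)
    \<comment> \<open>Robot 1 stands on node 1 and reads \<open>towards n\<close> in the minus
      direction, so this draw takes it to node 0.\<close>
    moreover have "(\<lambda>_. Idle)(1 := Move (towards n)) \<in>
        PiE_dflt {1} Idle (\<lambda>r. set_pmf (P (view (config_of n ?p) (?p ! r))))"
      using True \<gamma> by (auto simp: PiE_dflt_def view_def insert_commute)
    moreover have "[0, 0] = map (\<lambda>r. target (config_of n ?p) (?p ! r) True
        (((\<lambda>_. Idle)(1 := Move (towards n))) r)) [0..<length ?p]"
      using \<gamma> pred towards_neq_away[OF assms] by simp
    ultimately have "[0, 0] \<in> ?S"
      by (simp only: set_pmf_step finite.intros) (auto simp only: round_robin_def adversary.simps)
    then obtain X where X: "run n P (round_robin 2) ?p X" "X 1 = [0, 0]"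
        "terminates n P X" "visits_all n X"
      by (rule good_run)
    have plX: "is_placement n 2 (X t)" for t
      by (rule run_is_placement[OF X(1) pl])
    obtain t where t: "terminal P (config_of n (X t))"
      using X(3) by (auto simp: terminates_def)
    obtain a b where ab: "X t = [a, b]"
      using plX[of t] by (auto simp: is_placement_def length_Suc_conv numeral_2_eq_2)
    \<comment> \<open>The run terminates somewhere, necessarily in a tower; terminality then
      transfers to the tower on node 0 created by the first move.\<close>
    have "a = b" "a < n"
      using not_term[OF plX[of t]] t plX[of t] by (auto simp: ab is_placement_def)
    then have "terminal P (config_of n [0, 0])"
      using t terminal_tower_iff[of a n 0] by (simp add: ab)
    then have late: "X t = [0, 0]" if "t \<ge> 1" for t
      using run_terminal_const[OF X(1) pl, of 1 t] X(2) that by simp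
    \<comment> \<open>The run is \<open>[0, 1]\<close> at instant 0 and \<open>[0, 0]\<close> ever
      after, while node 2 exists because \<open>n \<ge> 3\<close>.\<close>
    have "2 \<notin> set (X t)" for t
      using late[of t] X(1) by (cases t) (auto simp: run_def)
    then show False
      using X(4) assms by (auto simp: visits_all_def config_of_pos_iff dest: spec[of _ 2])
  next
    case False
    \<comment> \<open>In this case any first step will do.\<close>
    obtain q where "q \<in> ?S" using set_pmf_not_empty by fast
    then obtain X where X: "run n P (round_robin 2) ?p X" "terminates n P X"
      by (rule good_run)
    have plX: "is_placement n 2 (X t)" for t
      by (rule run_is_placement[OF X(1) pl])
    have "distinct (X t)" for t
    proof (induction t)
      case (Suc t)
      have "{Suc t mod 2} \<inter> {..<2} = {Suc t mod 2}" by auto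
      then show ?case
        using single_move_distinct[OF assms prot False plX Suc] round_robin_run_step[OF X(1), of t]
        by simp
    qed (use X(1) in \<open>simp add: run_def\<close>)
    then show False
      using X(2) not_term plX by (auto simp: terminates_def)
  qed
qed

section \<open>At most one robot, and the combination of the cases\<close>

text \<open>A single robot is always towerless, so no placement along the run is terminal.\<close>

lemma no_exploration_one_robot:
  assumes "n \<ge> 2"
  shows "\<not> exploration_protocol n 1 P"
proof
  assume expl: "exploration_protocol n 1 P"
  have init: "initial n 1 p" if "is_placement n 1 p" for p
    using that towerless_config_of_iff[OF that]
    by (auto simp: initial_def is_placement_def length_Suc_conv)
  have pl: "is_placement n 1 [0]" using assms by (simp add: is_placement_def)
  obtain q where
    "q \<in> set_pmf (step n P (act (round_robin 1) [[0]]) (edge (round_robin 1) [[0]]) [0])"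
    using set_pmf_not_empty by fast
  then obtain X where X: "run n P (round_robin 1) [0] X" "terminates n P X"
    by (rule exploration_protocol_good_run[OF expl init[OF pl] fair_round_robin])
  then show False
    using initial_not_terminal[OF expl _ init[OF run_is_placement[OF X(1) pl]]] assms
    by (auto simp: terminates_def)
qed

lemma no_exploration_zero_robots:
  assumes "n \<ge> 1"
  shows "\<not> exploration_protocol n 0 P"
proof
  assume expl: "exploration_protocol n 0 P"
  have "initial n 0 []"
    by (simp add: initial_def is_placement_def towerless_def config_of_def)
  \<comment> \<open>Without robots terminality is vacuous, so the start is already terminal although
    no node has been visited.\<close>
  moreover have "terminal P (config_of n [])"
    by (simp add: terminal_def config_of_pos_iff)
  ultimately show False
    using initial_not_terminal[OF expl] assms by simp
qed

theorem theorem1: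
  fixes n k :: nat
  assumes "0 \<le> k" and "k < 3" and "n > k"
  shows "\<not> (\<exists>P. exploration_protocol n k P)"
proof -
  consider "k = 0" | "k = 1" | "k = 2" using assms(2) by linarith
  then show ?thesis
    using assms(3) no_exploration_zero_robots no_exploration_one_robot no_exploration_two_robots
    by cases auto
qed

end
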